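(* Let $k\geq 2$ be an integer. For a non-negative integer $n$, let $B_{0,k}(n)$ be the number of partitions of $n$ in which each part is either even but $\not\equiv 2 \pmod{4k}$, or odd and $\equiv 1 \text{ or } 2k+1 \pmod{4k}$. Also, let $C_{0,k}(n)$ be the number of partitions of $n$ in which, if an odd part $2j+1$ is present, then none of the other parts are equal to any of $2j+1,2j+2,\dots,2j+2k-1$. Then $B_{0,k}(n) = C_{0,k}(n)$ for all $n$.
   Context: A partition of $n$ is a finite multiset of positive integers (its parts) with sum $n$; the empty partition is the only partition of $0$. "None of the other parts" refers to the remaining parts counted with multiplicity after removing one copy of $2j+1$; in particular, no odd part is repeated in a partition counted by $C_{0,k}(n)$. The list $2j+1,2j+2,\dots,2j+2k-1$ consists of all consecutive integers from $2j+1$ to $2j+2k-1$. *)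

theory Defs
  imports "HOL-Library.Multiset" "HOL-Number_Theory.Cong"
begin

definition partitions :: "nat \<Rightarrow> nat multiset set" where
  "partitions n = {P. (\<forall>p\<in>#P. 0 < p) \<and> sum_mset P = n}"

definition B0 :: "nat \<Rightarrow> nat \<Rightarrow> nat" where
  "B0 k n = card {P \<in> partitions n. \<forall>p\<in>#P.
     (even p \<and> \<not> [p = 2] (mod (4 * k))) \<or>
     (odd p \<and> ([p = 1] (mod (4 * k)) \<or> [p = 2 * k + 1] (mod (4 * k))))}"

text \<open>The other parts are those left after removing a single copy of the odd part,
  so a second copy of that part is excluded as well.\<close>

definition C0 :: "nat \<Rightarrow> nat \<Rightarrow> nat" where
  "C0 k n = card {P \<in> partitions n. \<forall>j. 2 * j + 1 \<in># P \<longrightarrow>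
     (\<forall>q \<in># P - {#2 * j + 1#}. q \<notin> {2 * j + 1..2 * j + 2 * k - 1})}"

end

theory Submission
  imports Defs "HOL-Computational_Algebra.Formal_Power_Series"
begin

text \<open>Euler's trick turns the generating function of \<open>B0\<close> into
  \<open>(\<Prod>m. 1 + X ^ (2 * k * m + 1)) / (\<Prod>i\<ge>1. 1 - X ^ (2 * i))\<close>. On the other side let \<open>H s\<close>
  be the series of the partitions counted by \<open>C0\<close>, where every odd part \<open>p\<close> contributes
  \<open>p + 2 * k * s\<close> to the exponent. Then \<open>H s = (1 + X ^ (2 * k * s + 1)) * H (s + 1)\<close>, and
  \<open>H s\<close> tends to the series of the partitions into even parts as \<open>s\<close> grows.
  A bounded version of the functional equation follows from a recurrence in the bound on
  the parts, obtained by removing the largest even or the largest odd part allowed.\<close>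

section \<open>Generating functions of classes of partitions\<close>

unbundle fps_syntax

definition pgf :: "(nat multiset \<Rightarrow> bool) \<Rightarrow> rat fps" where
  "pgf Q = Abs_fps (\<lambda>n. of_nat (card {P \<in> partitions n. Q P}))"

lemma pgf_nth: "pgf Q $ n = of_nat (card {P \<in> partitions n. Q P})"
  by (simp add: pgf_def)

lemma part_le_sum_mset: "(p::nat) \<in># P \<Longrightarrow> p \<le> sum_mset P"
  by (auto dest!: multi_member_split)

lemma finite_partitions: "finite (partitions n)"
proof -
  have "P \<in> (\<Union>m\<le>n. multisets_of_size {..n} m)" if "P \<in> partitions n" for P
  proof -
    have "size P \<le> n"
    proof -
      have "\<forall>p\<in>#P. 0 < p \<Longrightarrow> size P \<le> sum_mset P"
        by (induction P) auto
      then show ?thesis using that by (auto simp: partitions_def)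
    qed
    moreover have "set_mset P \<subseteq> {..n}"
      using that part_le_sum_mset by (auto simp: partitions_def)
    ultimately show ?thesis by (auto simp: multisets_of_size_def)
  qed
  then have "partitions n \<subseteq> (\<Union>m\<le>n. multisets_of_size {..n} m)" by blast
  then show ?thesis
    by (rule finite_subset) (auto intro: finite_multisets_of_size)
qed

lemma pgf_cong:
  assumes "\<And>P. \<forall>p\<in>#P. 0 < p \<Longrightarrow> Q P \<longleftrightarrow> Q' P"
  shows "pgf Q = pgf Q'"
proof -
  have "{P \<in> partitions n. Q P} = {P \<in> partitions n. Q' P}" for n
    using assms by (auto simp: partitions_def)
  then show ?thesis by (simp add: pgf_def)
qed

lemma pgf_disj:
  assumes "\<And>P. Q P \<Longrightarrow> \<not> Q' P"
  shows "pgf (\<lambda>P. Q P \<or> Q' P) = pgf Q + pgf Q'"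
proof (rule fps_ext)
  fix n
  have "{P \<in> partitions n. Q P \<or> Q' P} = {P \<in> partitions n. Q P} \<union> {P \<in> partitions n. Q' P}"
    by blast
  then show "pgf (\<lambda>P. Q P \<or> Q' P) $ n = (pgf Q + pgf Q') $ n"
    using assms finite_partitions[of n]
    by (simp add: pgf_nth) (subst card_Un_disjoint, auto)
qed

text \<open>Deleting one copy of \<open>a\<close> maps these partitions of \<open>n\<close>
  bijectively onto the partitions of \<open>n - a\<close> satisfying \<open>Q\<close>; since
  \<open>a\<close> is positive, inserting it again yields a partition.\<close>

lemma pgf_remove_part:
  assumes "0 < a"
  shows "pgf (\<lambda>P. a \<in># P \<and> Q (P - {#a#})) = fps_X ^ a * pgf Q"
proof (rule fps_ext)
  fix n
  let ?S = "{P \<in> partitions n. a \<in># P \<and> Q (P - {#a#})}"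
  show "pgf (\<lambda>P. a \<in># P \<and> Q (P - {#a#})) $ n = (fps_X ^ a * pgf Q) $ n"
  proof (cases "n < a")
    case True
    then have "?S = {}"
      using part_le_sum_mset by (fastforce simp: partitions_def)
    then have "card ?S = 0" by (simp only: card.empty)
    then show ?thesis using True by (simp add: pgf_nth fps_X_power_mult_nth)
  next
    case False
    have "?S = add_mset a ` {P \<in> partitions (n - a). Q P}" (is "_ = ?T")
    proof
      show "?S \<subseteq> ?T"
      proof
        fix P assume P: "P \<in> ?S"
        then obtain R where R: "P = add_mset a R" by (auto dest: multi_member_split)
        with P show "P \<in> ?T" by (auto simp: partitions_def)
      qed
      show "?T \<subseteq> ?S" using False assms by (auto simp: partitions_def)
    qed
    moreover have "inj_on (add_mset a) X" for X by (simp add: inj_on_def)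
    ultimately have "card ?S = card {P \<in> partitions (n - a). Q P}"
      by (simp add: card_image)
    then show ?thesis using False by (simp add: pgf_nth fps_X_power_mult_nth)
  qed
qed

lemma pgf_empty: "pgf (\<lambda>P. P = {#}) = 1"
proof (rule fps_ext)
  fix n
  have "{P \<in> partitions n. P = {#}} = (if n = 0 then {{#}} else {})"
    by (auto simp: partitions_def)
  then show "pgf (\<lambda>P. P = {#}) $ n = 1 $ n" by (simp add: pgf_nth)
qed

text \<open>A partition with parts in \<open>insert a A\<close> either avoids \<open>a\<close>, or
  one copy of \<open>a\<close> can be removed and leaves a partition of the same kind. Hence
  adjoining \<open>a\<close> to \<open>A\<close> divides the series by
  \<open>1 - fps_X ^ a\<close>.\<close>

lemma pgf_parts_in:
  assumes "finite A" "0 \<notin> A"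
  shows "pgf (\<lambda>P. set_mset P \<subseteq> A) * (\<Prod>a\<in>A. 1 - fps_X ^ a) = 1"
  using assms
proof (induction A rule: finite_induct)
  case empty
  then show ?case using pgf_empty by simp
next
  case (insert a A)
  let ?G = "pgf (\<lambda>P. set_mset P \<subseteq> insert a A)"
  have "set_mset P \<subseteq> insert a A \<longleftrightarrow>
      set_mset P \<subseteq> A \<or> (a \<in># P \<and> set_mset (P - {#a#}) \<subseteq> insert a A)" for P
  proof (cases "a \<in># P")
    case True
    then obtain R where "P = add_mset a R" by (auto dest: multi_member_split)
    then show ?thesis using insert.hyps by auto
  next
    case False
    then show ?thesis by (simp add: subset_insert)
  qed
  then have "?G = pgf (\<lambda>P. set_mset P \<subseteq> A \<or>
      (a \<in># P \<and> set_mset (P - {#a#}) \<subseteq> insert a A))"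
    by (intro arg_cong[where f = pgf] ext)
  also have "\<dots> = pgf (\<lambda>P. set_mset P \<subseteq> A) + fps_X ^ a * ?G"
    using insert.hyps insert.prems
      pgf_remove_part[of a "\<lambda>P. set_mset P \<subseteq> insert a A"]
    by (subst pgf_disj) auto
  finally have step: "?G * (1 - fps_X ^ a) = pgf (\<lambda>P. set_mset P \<subseteq> A)"
    unfolding right_diff_distrib mult_1_right diff_eq_eq by (rule trans) (simp only: mult.commute)
  show ?case
    unfolding prod.insert[OF insert.hyps] mult.assoc[symmetric] step
    using insert.IH insert.prems by blast
qed

section \<open>The gap condition and its recurrence in the bound\<close>

definition gap_cond :: "nat \<Rightarrow> nat multiset \<Rightarrow> bool" where
  "gap_cond k P \<longleftrightarrow> (\<forall>j. 2 * j + 1 \<in># P \<longrightarrow>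
     (\<forall>q \<in># P - {#2 * j + 1#}. q \<notin> {2 * j + 1..2 * j + 2 * k - 1}))"

text \<open>Besides all parts, also the whole forbidden range above each odd part must lie
  below \<open>2 * J\<close>; this is what makes the recurrence in \<open>J\<close> close up.\<close>

definition gap_upto :: "nat \<Rightarrow> nat \<Rightarrow> nat multiset \<Rightarrow> bool" where
  "gap_upto k J P \<longleftrightarrow> gap_cond k P \<and>
     (\<forall>p\<in>#P. p \<le> 2 * J \<and> (odd p \<longrightarrow> p + 2 * k \<le> 2 * J + 1))"

text \<open>The forbidden range of an odd part \<open>p\<close> is
  \<open>{p..p + 2 * k - 2}\<close>. Inserting \<open>a\<close> creates two new kinds of pairs:
  \<open>a\<close> as the odd part against members of \<open>R\<close>, and odd members of
  \<open>R\<close> against \<open>a\<close>.\<close>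

lemma gap_cond_add_mset:
  assumes "0 < k"
  shows "gap_cond k (add_mset a R) \<longleftrightarrow> gap_cond k R \<and>
    (odd a \<longrightarrow> (\<forall>q\<in>#R. q < a \<or> a + 2 * k - 1 \<le> q)) \<and>
    (\<forall>p\<in>#R. odd p \<longrightarrow> a < p \<or> p + 2 * k - 1 \<le> a)"
    (is "?L \<longleftrightarrow> ?R")
proof
  assume L: ?L
  have "gap_cond k R"
    unfolding gap_cond_def
  proof (intro allI impI ballI)
    fix j q assume "2 * j + 1 \<in># R" "q \<in># R - {#2 * j + 1#}"
    moreover from this have "q \<in># add_mset a R - {#2 * j + 1#}"
      by (auto dest!: multi_member_split)
    ultimately show "q \<notin> {2 * j + 1..2 * j + 2 * k - 1}"
      using L by (auto simp: gap_cond_def)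
  qed
  moreover have "q < a \<or> a + 2 * k - 1 \<le> q" if "odd a" "q \<in># R" for q
  proof -
    obtain j where "a = 2 * j + 1" using \<open>odd a\<close> by (auto elim: oddE)
    then show ?thesis using L that by (fastforce simp: gap_cond_def)
  qed
  moreover have "a < p \<or> p + 2 * k - 1 \<le> a" if "odd p" "p \<in># R" for p
  proof -
    obtain j where "p = 2 * j + 1" using \<open>odd p\<close> by (auto elim: oddE)
    moreover have "a \<in># add_mset a R - {#p#}" using that by auto
    ultimately show ?thesis using L that by (fastforce simp: gap_cond_def)
  qed
  ultimately show ?R by blast
next
  assume R: ?R
  show ?L
    unfolding gap_cond_def
  proof (intro allI impI ballI)
    fix j q assume j: "2 * j + 1 \<in># add_mset a R"
      and q: "q \<in># add_mset a R - {#2 * j + 1#}"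
    show "q \<notin> {2 * j + 1..2 * j + 2 * k - 1}"
    proof (cases "2 * j + 1 = a")
      case True
      then have "q \<in># R" "odd a" using q by auto
      then show ?thesis using R True by fastforce
    next
      case False
      then have jR: "2 * j + 1 \<in># R" using j by auto
      then have "q = a \<or> q \<in># R - {#2 * j + 1#}" using q False by auto
      then show ?thesis
      proof
        assume "q = a"
        then show ?thesis using R jR by fastforce
      next
        assume "q \<in># R - {#2 * j + 1#}"
        then show ?thesis using R jR by (auto simp: gap_cond_def)
      qed
    qed
  qed
qed

text \<open>All forbidden ranges end below \<open>2 * J\<close>, so this part can be added freely,
  in any multiplicity.\<close>

lemma gap_upto_add_even:
  assumes "0 < k"
  shows "gap_upto k J (add_mset (2 * J) R) \<longleftrightarrow> gap_upto k J R"
proof -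
  have "2 * J < p \<or> p + 2 * k - 1 \<le> 2 * J" if "p + 2 * k \<le> 2 * J + 1" for p
    using that by linarith
  then show ?thesis
    unfolding gap_upto_def gap_cond_add_mset[OF assms] by simp blast
qed

text \<open>The range of the largest odd part allowed, \<open>2 * (J - k) + 1\<close>, ends at
  \<open>2 * J - 1\<close>. Once \<open>2 * J\<close> is excluded too, the other parts must lie
  below that odd part, and their own ranges must miss it.\<close>

lemma gap_upto_add_odd:
  assumes "0 < k" "k \<le> J"
  shows "gap_upto k J (add_mset (2 * (J - k) + 1) R) \<and> 2 * J \<notin># R \<longleftrightarrow>
    gap_upto k (J - k) R" (is "?L \<longleftrightarrow> ?R")
proof -
  obtain i where J: "J = i + k" using assms(2) by (metis le_add_diff_inverse2)
  show ?thesis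
  proof
    assume L: ?L
    have "p \<le> 2 * i \<and> (odd p \<longrightarrow> p + 2 * k \<le> 2 * i + 1)" if p: "p \<in># R" for p
    proof -
      have "p < 2 * i + 1 \<or> 2 * i + 2 * k \<le> p"
        using L p assms(1) by (fastforce simp: gap_upto_def gap_cond_add_mset J)
      moreover have "p \<le> 2 * i + 2 * k" "p \<noteq> 2 * i + 2 * k"
        using L p by (auto simp: gap_upto_def J)
      ultimately have le: "p \<le> 2 * i" by linarith
      moreover have "p + 2 * k \<le> 2 * i + 1" if "odd p"
      proof -
        have "2 * i + 1 < p \<or> p + 2 * k - 1 \<le> 2 * i + 1"
          using L p assms(1) that by (fastforce simp: gap_upto_def gap_cond_add_mset J)
        then have "p + 2 * k \<le> 2 * i + 2" using le by linarith
        \<comment> \<open>Parity sharpens the bound by one: \<open>p + 2 * k\<close> is odd.\<close>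
        moreover have "p + 2 * k \<noteq> 2 * i + 2" using that by presburger
        ultimately show ?thesis by linarith
      qed
      ultimately show ?thesis by blast
    qed
    then show ?R
      using L assms(1) by (auto simp: gap_upto_def gap_cond_add_mset J)
  next
    assume R: ?R
    then have "2 * J \<notin># R" using assms(1) by (fastforce simp: gap_upto_def J)
    moreover have "gap_upto k J (add_mset (2 * (J - k) + 1) R)"
      using R assms(1) by (fastforce simp: gap_upto_def gap_cond_add_mset J)
    ultimately show ?L by blast
  qed
qed

text \<open>Lowering the bound by one excludes just the largest even and the largest odd part. For
  \<open>J < k\<close> no odd part is allowed, and the guard keeps the truncated
  \<open>J - k\<close> from excluding 1.\<close>

lemma gap_upto_pred:
  assumes "0 < k" "0 < J"
  shows "gap_upto k J P \<and> 2 * J \<notin># P \<and> (k \<le> J \<longrightarrow> 2 * (J - k) + 1 \<notin># P)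
    \<longleftrightarrow> gap_upto k (J - 1) P" (is "?L \<longleftrightarrow> ?R")
proof
  assume L: ?L
  have "p \<le> 2 * (J - 1) \<and> (odd p \<longrightarrow> p + 2 * k \<le> 2 * (J - 1) + 1)" if p: "p \<in># P" for p
  proof -
    have *: "p \<le> 2 * J" "p \<noteq> 2 * J" "odd p \<longrightarrow> p + 2 * k \<le> 2 * J + 1"
        "k \<le> J \<longrightarrow> p \<noteq> 2 * (J - k) + 1"
      using L p by (auto simp: gap_upto_def)
    show ?thesis
    proof (cases "odd p")
      case True
      then obtain j where "p = 2 * j + 1" by (auto elim: oddE)
      then show ?thesis using * True assms by auto
    next
      case False
      then obtain j where "p = 2 * j" by auto
      then show ?thesis using * False by auto
    qed
  qed
  then show ?R using L by (auto simp: gap_upto_def)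
next
  assume ?R
  then show ?L using assms by (fastforce simp: gap_upto_def)
qed

text \<open>The three cases are: \<open>2 * J\<close> occurs, and deleting a copy keeps the bound;
  neither extreme part occurs; only the extreme odd part occurs, and deleting it lowers the bound to
  \<open>J - k\<close>.\<close>

lemma gap_upto_step:
  assumes "0 < k" "0 < J"
  shows "gap_upto k J P \<longleftrightarrow>
    (2 * J \<in># P \<and> gap_upto k J (P - {#2 * J#})) \<or> (gap_upto k (J - 1) P \<or>
    (2 * (J - k) + 1 \<in># P \<and> (k \<le> J \<and> gap_upto k (J - k) (P - {#2 * (J - k) + 1#}))))"
proof (cases "2 * J \<in># P")
  case True
  then obtain R where R: "P = add_mset (2 * J) R" by (auto dest: multi_member_split)
  then show ?thesis
    using gap_upto_add_even[OF assms(1), of J R] gap_upto_pred[OF assms, of P]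
      gap_upto_add_odd[OF assms(1), of J "P - {#2 * (J - k) + 1#}"]
    by auto
next
  case even: False
  show ?thesis
  proof (cases "k \<le> J \<and> 2 * (J - k) + 1 \<in># P")
    case True
    then obtain R where "P = add_mset (2 * (J - k) + 1) R" by (auto dest: multi_member_split)
    then show ?thesis
      using gap_upto_add_odd[OF assms(1), of J R] gap_upto_pred[OF assms, of P] even True
      by auto
  next
    case False
    then show ?thesis using gap_upto_pred[OF assms, of P] even by auto
  qed
qed

lemma pgf_gap_upto_rec:
  assumes "0 < k" "0 < J"
  shows "(1 - fps_X ^ (2 * J)) * pgf (gap_upto k J) = pgf (gap_upto k (J - 1)) +
    fps_X ^ (2 * (J - k) + 1) * (if k \<le> J then pgf (gap_upto k (J - k)) else 0)"
proof -
  let ?A = "\<lambda>P. 2 * J \<in># P \<and> gap_upto k J (P - {#2 * J#})"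
  let ?C = "\<lambda>P. 2 * (J - k) + 1 \<in># P \<and>
      (k \<le> J \<and> gap_upto k (J - k) (P - {#2 * (J - k) + 1#}))"
  have "pgf (gap_upto k J) = pgf (\<lambda>P. ?A P \<or> (gap_upto k (J - 1) P \<or> ?C P))"
    using gap_upto_step[OF assms] by (intro pgf_cong) blast
  also have "\<dots> = pgf ?A + pgf (\<lambda>P. gap_upto k (J - 1) P \<or> ?C P)"
  proof (rule pgf_disj)
    fix P assume A: "?A P"
    \<comment> \<open>The removed odd part is not \<open>2 * J\<close>, so \<open>2 * J\<close>
      survives and violates the bound \<open>J - k\<close>.\<close>
    moreover have "2 * (J - k) + 1 \<noteq> 2 * J" by presburger
    ultimately have "2 * J \<in># P - {#2 * (J - k) + 1#}"
      by (simp add: in_diff_count)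
    with A show "\<not> (gap_upto k (J - 1) P \<or> ?C P)"
      using gap_upto_pred[OF assms, of P]
        gap_upto_add_odd[OF assms(1), of J "P - {#2 * (J - k) + 1#}"]
        insert_DiffM[of "2 * (J - k) + 1" P]
      by auto
  qed
  also have "pgf (\<lambda>P. gap_upto k (J - 1) P \<or> ?C P) = pgf (gap_upto k (J - 1)) + pgf ?C"
    using gap_upto_pred[OF assms] by (intro pgf_disj) blast
  also have "pgf ?A = fps_X ^ (2 * J) * pgf (gap_upto k J)"
    using assms(2) by (simp add: pgf_remove_part)
  also have "pgf ?C = fps_X ^ (2 * (J - k) + 1) * pgf (\<lambda>P. k \<le> J \<and> gap_upto k (J - k) P)"
    by (intro pgf_remove_part) simp
  also have "pgf (\<lambda>P. k \<le> J \<and> gap_upto k (J - k) P) =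
      (if k \<le> J then pgf (gap_upto k (J - k)) else 0)"
    by (auto simp: fps_eq_iff pgf_nth)
  finally show ?thesis
    unfolding left_diff_distrib mult_1_left diff_eq_eq by (rule trans) (rule add.commute)
qed

lemma pgf_gap_upto_0:
  assumes "0 < k"
  shows "pgf (gap_upto k 0) = 1"
proof -
  have "pgf (gap_upto k 0) = pgf (\<lambda>P. P = {#})"
  proof (rule pgf_cong)
    fix P :: "nat multiset" assume "\<forall>p\<in>#P. 0 < p"
    then show "gap_upto k 0 P \<longleftrightarrow> P = {#}"
      by (cases P) (auto simp: gap_upto_def gap_cond_def)
  qed
  then show ?thesis by (simp add: pgf_empty)
qed

section \<open>The family of series with shifted odd parts\<close>

text \<open>The series \<open>H s\<close> restricted to the partitions satisfying \<open>gap_upto k J\<close>; only the case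
  \<open>s = 0\<close> is linked to actual partitions, so the recurrence serves as the definition.\<close>

fun gap_fps :: "nat \<Rightarrow> nat \<Rightarrow> nat \<Rightarrow> rat fps" where
  "gap_fps k s J = (if J = 0 then 1 else inverse (1 - fps_X ^ (2 * J)) *
     (gap_fps k s (J - 1) + fps_X ^ (2 * (J - k) + 1 + 2 * k * s) *
       (if 0 < k \<and> k \<le> J then gap_fps k s (J - k) else 0)))"

declare gap_fps.simps [simp del]

lemma gap_fps_0 [simp]: "gap_fps k s 0 = 1"
  by (simp add: gap_fps.simps)

text \<open>The default 0 for \<open>J < k\<close> overrides truncated subtraction, which would give
  the series 1.\<close>

definition gap_fps_shift :: "nat \<Rightarrow> nat \<Rightarrow> nat \<Rightarrow> rat fps" where
  "gap_fps_shift k s J = (if k \<le> J then gap_fps k s (J - k) else 0)"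

lemma one_minus_X_power_nonzero: "0 < a \<Longrightarrow> (1 - fps_X ^ a) $ 0 \<noteq> (0 :: rat)"
  by simp

lemma gap_fps_rec:
  assumes "0 < k" "0 < J"
  shows "(1 - fps_X ^ (2 * J)) * gap_fps k s J =
    gap_fps k s (J - 1) + fps_X ^ (2 * (J - k) + 1 + 2 * k * s) * gap_fps_shift k s J"
proof -
  have "(1 - fps_X ^ (2 * J) :: rat fps) * inverse (1 - fps_X ^ (2 * J)) = 1"
    using one_minus_X_power_nonzero[of "2 * J"] assms
    by (metis inverse_mult_eq_1' nat_0_less_mult_iff zero_less_numeral)
  then show ?thesis
    using assms by (subst gap_fps.simps) (simp add: gap_fps_shift_def flip: mult.assoc)
qed

lemma pgf_gap_upto:
  assumes "0 < k"
  shows "pgf (gap_upto k J) = gap_fps k 0 J"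
proof (induction J rule: less_induct)
  case (less J)
  show ?case
  proof (cases "J = 0")
    case True
    then show ?thesis using pgf_gap_upto_0[OF assms] by simp
  next
    case False
    then have "(1 - fps_X ^ (2 * J)) * pgf (gap_upto k J) =
        (1 - fps_X ^ (2 * J)) * gap_fps k 0 J"
      using assms less
      by (simp only: pgf_gap_upto_rec gap_fps_rec gap_fps_shift_def) simp
    moreover have "1 - fps_X ^ (2 * J) \<noteq> (0 :: rat fps)"
      using one_minus_X_power_nonzero[of "2 * J"] False by fastforce
    ultimately show ?thesis by simp
  qed
qed

text \<open>Both sides satisfy the recurrence of \<open>gap_fps_rec\<close> for \<open>s\<close>.\<close>

lemma gap_fps_functional_equation:
  assumes "0 < k"
  shows "gap_fps k s J =
    gap_fps k (Suc s) J + fps_X ^ (2 * k * s + 1) * gap_fps_shift k (Suc s) J"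
proof (induction J rule: less_induct)
  case (less J)
  let ?H = "gap_fps k s" and ?H' = "gap_fps k (Suc s)" and ?T' = "gap_fps_shift k (Suc s)"
  let ?z = "fps_X ^ (2 * k * s + 1) :: rat fps"
  show ?case
  proof (cases "J = 0")
    case True
    then show ?thesis using assms by (simp add: gap_fps_shift_def)
  next
    case False
    have pred: "?H (J - 1) = ?H' (J - 1) + ?z * ?T' (J - 1)"
      using less False by simp
    have "(1 - fps_X ^ (2 * J)) * ?H J = (1 - fps_X ^ (2 * J)) * (?H' J + ?z * ?T' J)"
    proof (cases "k \<le> J")
      case kJ: False
      then have "?T' J = 0" "?T' (J - 1) = 0" "gap_fps_shift k s J = 0"
        by (auto simp: gap_fps_shift_def)
      then show ?thesis
        using gap_fps_rec[OF assms, of J] False pred by simp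
    next
      case True
      define u :: "rat fps" where "u = fps_X ^ (2 * (J - k))"
      define x :: "rat fps" where "x = fps_X ^ (2 * k)"
      have J: "fps_X ^ (2 * J) = u * x"
        using True by (simp add: u_def x_def flip: power_add distrib_left)
      have H: "?H (J - k) = ?H' (J - k) + ?z * ?T' (J - k)"
        using less[of "J - k"] assms False by simp
      have "(1 - fps_X ^ (2 * J)) * ?H J = ?H (J - 1) + u * ?z * ?H (J - k)"
        using gap_fps_rec[OF assms, of J s] False True
        by (simp add: gap_fps_shift_def u_def power_add mult.assoc)
      also have "\<dots> = ?H' (J - 1) + ?z * ?T' (J - 1)
          + u * ?z * (?H' (J - k) + ?z * ?T' (J - k))"
        by (simp only: pred H)
      finally have 1: "(1 - fps_X ^ (2 * J)) * ?H J = \<dots>" .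
      have T: "?T' J = ?H' (J - k)" using True by (simp add: gap_fps_shift_def)
      have 2: "(1 - fps_X ^ (2 * J)) * ?H' J = ?H' (J - 1) + u * ?z * x * ?T' J"
        using gap_fps_rec[OF assms, of J "Suc s"] False
        by (simp add: u_def x_def power_add algebra_simps)
      \<comment> \<open>This is the recurrence of \<open>?H'\<close> at \<open>J - k\<close>. It
        needs a positive bound; for \<open>J = k\<close> both sides vanish because
        \<open>u = 1\<close>.\<close>
      have 3: "(1 - u) * ?T' J = ?T' (J - 1) + u * ?z * ?T' (J - k)"
      proof (cases "J = k")
        case True
        then show ?thesis using assms by (simp add: u_def gap_fps_shift_def)
      next
        case False
        have "(1 - u) * ?H' (J - k) = ?H' (J - k - 1) +
            fps_X ^ (2 * (J - k - k) + 1 + 2 * k * Suc s) * ?T' (J - k)"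
          using gap_fps_rec[OF assms, of "J - k" "Suc s"] False True by (simp add: u_def)
        also have "?H' (J - k - 1) = ?T' (J - 1)"
          using False True by (auto simp: gap_fps_shift_def algebra_simps)
        also have "fps_X ^ (2 * (J - k - k) + 1 + 2 * k * Suc s) * ?T' (J - k) =
            u * ?z * ?T' (J - k)"
        \<comment> \<open>The exponents agree only if \<open>J - k - k\<close> is not truncated;
          otherwise the shifted series is 0.\<close>
        proof (cases "k \<le> J - k")
          case True
          then have "2 * (J - k - k) + 1 + 2 * k * Suc s = 2 * (J - k) + (2 * k * s + 1)"
            by simp
          then show ?thesis by (simp only: u_def power_add)
        qed (simp add: gap_fps_shift_def)
        finally show ?thesis using T by simp
      qed
      \<comment> \<open>Split \<open>1 - u * x\<close> as \<open>(1 - u) + (u - u * x)\<close>: the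
        first summand fits equation \<open>3\<close>, and the \<open>u * x\<close> in the second
        cancels the last term of equation \<open>2\<close>.\<close>
      have "(1 - fps_X ^ (2 * J)) * (?H' J + ?z * ?T' J) =
          ?H' (J - 1) + u * ?z * x * ?T' J + ?z * ((1 - u) * ?T' J + (u - u * x) * ?T' J)"
        unfolding 2[symmetric] J by (simp add: algebra_simps)
      also have "\<dots> = ?H' (J - 1) + ?z * ?T' (J - 1)
          + u * ?z * (?H' (J - k) + ?z * ?T' (J - k))"
        unfolding 3 unfolding T by (simp add: algebra_simps)
      finally show ?thesis using 1 by simp
    qed
    moreover have "1 - fps_X ^ (2 * J) \<noteq> (0 :: rat fps)"
      using one_minus_X_power_nonzero[of "2 * J"] False by fastforce
    ultimately show ?thesis by simp
  qed
qed

section \<open>Limits in the bound and in the shift, as congruences modulo powers of X\<close>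

lemma X_power_dvd_mono: "a \<le> b \<Longrightarrow> (fps_X ^ a :: rat fps) dvd fps_X ^ b * f"
  by (simp add: dvd_mult2 le_imp_power_dvd)

text \<open>Raising the bound by one changes the series only by terms of degree at least
  \<open>2 * (J - k)\<close>, which is at least \<open>N\<close>.\<close>

lemma gap_fps_cong_large_J:
  assumes "0 < k" "N + 2 * k \<le> 2 * J"
  shows "fps_X ^ N dvd gap_fps k s (J + i) - gap_fps k s J"
proof (induction i)
  case (Suc i)
  have "gap_fps k s (J + Suc i) - gap_fps k s (J + i) =
      fps_X ^ (2 * (J + Suc i)) * gap_fps k s (J + Suc i) +
      fps_X ^ (2 * (J + Suc i - k) + 1 + 2 * k * s) * gap_fps_shift k s (J + Suc i)"
    using gap_fps_rec[OF assms(1), of "J + Suc i" s] by (simp add: algebra_simps)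
  also have "fps_X ^ N dvd \<dots>"
    using assms by (intro dvd_add X_power_dvd_mono) auto
  finally have "fps_X ^ N dvd gap_fps k s (J + Suc i) - gap_fps k s (J + i)" .
  from dvd_add[OF this Suc] show ?case by simp
qed simp

text \<open>Modulo \<open>fps_X ^ N\<close> the bounds \<open>J\<close> and \<open>J - k\<close>
  give the same series, so the functional equation becomes multiplication by
  \<open>1 + fps_X ^ (2 * k * s + 1)\<close> and can be iterated. Stability is used at
  \<open>J - k\<close>, hence \<open>4 * k\<close> in place of \<open>2 * k\<close>.\<close>

lemma gap_fps_cong_product:
  assumes "0 < k" "N + 4 * k \<le> 2 * J"
  shows "fps_X ^ N dvd gap_fps k 0 J - (\<Prod>m<M. 1 + fps_X ^ (2 * k * m + 1)) * gap_fps k M J"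
proof (induction M)
  case (Suc M)
  let ?p = "\<Prod>m<M. 1 + fps_X ^ (2 * k * m + 1) :: rat fps"
  let ?z = "fps_X ^ (2 * k * M + 1) :: rat fps"
  have "gap_fps k M J - (1 + ?z) * gap_fps k (Suc M) J =
      - ?z * (gap_fps k (Suc M) (J - k + k) - gap_fps k (Suc M) (J - k))"
    using gap_fps_functional_equation[OF assms(1), of M J] assms(2)
    by (simp add: gap_fps_shift_def algebra_simps)
  moreover have "fps_X ^ N dvd gap_fps k (Suc M) (J - k + k) - gap_fps k (Suc M) (J - k)"
    using assms by (intro gap_fps_cong_large_J) auto
  ultimately have "fps_X ^ N dvd ?p * (gap_fps k M J - (1 + ?z) * gap_fps k (Suc M) J)"
    by (metis dvd_mult)
  from dvd_add[OF Suc this] show ?case by (simp add: algebra_simps)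
qed simp

text \<open>The odd-part term of the recurrence carries \<open>fps_X ^ (2 * k * s)\<close> and
  vanishes modulo \<open>fps_X ^ N\<close>; what remains is the recurrence for even parts up to
  \<open>2 * J\<close>.\<close>

lemma gap_fps_cong_large_s:
  assumes "0 < k" "N \<le> 2 * k * s"
  shows "fps_X ^ N dvd gap_fps k s J * (\<Prod>i\<in>{1..J}. 1 - fps_X ^ (2 * i)) - 1"
proof (induction J)
  case (Suc J)
  let ?p = "\<Prod>i\<in>{1..J}. 1 - fps_X ^ (2 * i) :: rat fps"
  have "gap_fps k s (Suc J) * (\<Prod>i\<in>{1..Suc J}. 1 - fps_X ^ (2 * i)) - 1 =
      ((1 - fps_X ^ (2 * Suc J)) * gap_fps k s (Suc J)) * ?p - 1"
    by (simp add: algebra_simps)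
  also have "\<dots> = (gap_fps k s J * ?p - 1) +
      fps_X ^ (2 * (Suc J - k) + 1 + 2 * k * s) * (gap_fps_shift k s (Suc J) * ?p)"
    by (subst gap_fps_rec[OF assms(1)]) (simp_all add: algebra_simps)
  also have "fps_X ^ N dvd \<dots>"
    using assms by (intro dvd_add Suc X_power_dvd_mono) auto
  finally show ?case .
qed simp

section \<open>Euler's trick for the parts allowed in \<open>B0\<close>\<close>

text \<open>A finite cutoff of the allowed parts. The deleted even numbers are exactly the doubles
  of the odd parts, so the pairing stays exact for each \<open>M\<close>.\<close>

definition B_parts :: "nat \<Rightarrow> nat \<Rightarrow> nat set" where
  "B_parts k M = ((\<lambda>i. 2 * i) ` {1..2 * k * M} - (\<lambda>m. 2 * (2 * k * m + 1)) ` {..<M})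
     \<union> (\<lambda>m. 2 * k * m + 1) ` {..<M}"

text \<open>For each odd part \<open>a\<close>, the factor of its deleted double is
  \<open>1 - fps_X ^ (2 * a) = (1 - fps_X ^ a) * (1 + fps_X ^ a)\<close>. The first factor belongs
  to \<open>a\<close> itself, the second is left over.\<close>

lemma pgf_B_parts:
  assumes "0 < k"
  shows "pgf (\<lambda>P. set_mset P \<subseteq> B_parts k M) * (\<Prod>i\<in>{1..2 * k * M}. 1 - fps_X ^ (2 * i)) =
    (\<Prod>m<M. 1 + fps_X ^ (2 * k * m + 1))"
proof -
  let ?E = "(\<lambda>i. 2 * i) ` {1..2 * k * M}"
  let ?T = "(\<lambda>m. 2 * (2 * k * m + 1)) ` {..<M}"
  let ?O = "(\<lambda>m. 2 * k * m + 1) ` {..<M}"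
  let ?f = "\<lambda>a. 1 - fps_X ^ a :: rat fps"
  have "?T \<subseteq> ?E"
  proof
    fix p assume "p \<in> ?T"
    then obtain m where m: "m < M" "p = 2 * (2 * k * m + 1)" by auto
    have "2 * k * m + 1 \<le> 2 * k * Suc m" using assms by simp
    also have "\<dots> \<le> 2 * k * M" using m by (intro mult_le_mono2) simp
    finally show "p \<in> ?E" using m by (intro image_eqI[where x = "2 * k * m + 1"]) auto
  qed
  then have E: "prod ?f ?E = prod ?f (?E - ?T) * prod ?f ?T"
    by (intro prod.subset_diff) auto
  have "prod ?f ?T = (\<Prod>m<M. ?f (2 * (2 * k * m + 1)))"
    using assms by (subst prod.reindex) (auto simp: inj_on_def)
  also have "\<dots> = (\<Prod>m<M. ?f (2 * k * m + 1) * (1 + fps_X ^ (2 * k * m + 1)))"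
  proof (rule prod.cong)
    have "1 - y ^ 2 = (1 - y) * (1 + y)" for y :: "rat fps"
      by (simp add: algebra_simps power2_eq_square)
    then show "?f (2 * (2 * k * m + 1)) = ?f (2 * k * m + 1) * (1 + fps_X ^ (2 * k * m + 1))" for m
      by (metis mult.commute power_mult)
  qed simp
  also have "\<dots> = prod ?f ?O * (\<Prod>m<M. 1 + fps_X ^ (2 * k * m + 1))"
    using assms by (subst prod.reindex) (auto simp: inj_on_def prod.distrib)
  finally have T: "prod ?f ?T = \<dots>" .
  have "even p" if "p \<in> ?E" for p using that by auto
  moreover have "odd p" if "p \<in> ?O" for p using that by auto
  ultimately have disj: "?E \<inter> ?O = {}" by blast
  have "prod ?f (B_parts k M) = prod ?f (?E - ?T) * prod ?f ?O"
    unfolding B_parts_def by (rule prod.union_disjoint) (simp, simp, use disj in blast)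
  moreover have "prod ?f ?E = (\<Prod>i\<in>{1..2 * k * M}. ?f (2 * i))"
    by (subst prod.reindex) (auto simp: inj_on_def)
  moreover have "pgf (\<lambda>P. set_mset P \<subseteq> B_parts k M) * prod ?f (B_parts k M) = 1"
    by (rule pgf_parts_in) (auto simp: B_parts_def)
  ultimately show ?thesis using E T by (metis (no_types, lifting) mult.assoc mult_1)
qed

lemma fps_prod_nth_0: "(\<Prod>x\<in>A. f x) $ 0 = (\<Prod>x\<in>A. f x $ 0)"
  for f :: "'a \<Rightarrow> 'b::comm_ring_1 fps"
  by (induction A rule: infinite_finite_induct) auto

lemma mem_B_parts_iff:
  assumes "0 < k" "0 < p" "p < M"
  shows "p \<in> B_parts k M \<longleftrightarrow> (even p \<and> \<not> [p = 2] (mod (4 * k))) \<or>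
     (odd p \<and> ([p = 1] (mod (4 * k)) \<or> [p = 2 * k + 1] (mod (4 * k))))"
proof (cases "even p")
  case True
  then obtain i where i: "p = 2 * i" by auto
  have small: "i \<le> 2 * k * M"
  proof -
    have "i \<le> M" using assms i by simp
    also have "\<dots> \<le> 2 * k * M" using assms by simp
    finally show ?thesis .
  qed
  have "p \<in> (\<lambda>m. 2 * (2 * k * m + 1)) ` {..<M} \<longleftrightarrow> [p = 2] (mod (4 * k))"
  proof
    assume "[p = 2] (mod (4 * k))"
    then obtain m where "p = 4 * k * m + 2"
      using assms(2) i cong_le_nat[of 2 p "4 * k"] by (auto simp: mult.commute)
    moreover from this have "m < M"
    proof -
      have "m \<le> 4 * k * m" using assms(1) by simp
      then show ?thesis using \<open>p = 4 * k * m + 2\<close> assms(3) by linarith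
    qed
    ultimately show "p \<in> (\<lambda>m. 2 * (2 * k * m + 1)) ` {..<M}" by (auto intro!: image_eqI)
  next
    assume "p \<in> (\<lambda>m. 2 * (2 * k * m + 1)) ` {..<M}"
    then obtain m where "p = 4 * k * m + 2" using assms(1) by auto
    then show "[p = 2] (mod (4 * k))" by (simp only: cong_def mod_mult_self4)
  qed
  moreover have "p \<in> (\<lambda>i. 2 * i) ` {1..2 * k * M}" using i small assms by auto
  moreover have "p \<notin> (\<lambda>m. 2 * k * m + 1) ` {..<M}" using True by auto
  ultimately show ?thesis using True by (auto simp: B_parts_def)
next
  case False
  have "p \<in> (\<lambda>m. 2 * k * m + 1) ` {..<M} \<longleftrightarrow>
      [p = 1] (mod (4 * k)) \<or> [p = 2 * k + 1] (mod (4 * k))"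
  proof
    assume "p \<in> (\<lambda>m. 2 * k * m + 1) ` {..<M}"
    then obtain m where m: "p = 2 * k * m + 1" by auto
    show "[p = 1] (mod (4 * k)) \<or> [p = 2 * k + 1] (mod (4 * k))"
    proof (cases "even m")
      case True
      then obtain l where "m = 2 * l" by auto
      then have "p = 4 * k * l + 1" using m by simp
      then show ?thesis by (simp only: cong_def mod_mult_self4 simp_thms)
    next
      case False
      then obtain l where "m = 2 * l + 1" by (auto elim: oddE)
      then have "p = 4 * k * l + (2 * k + 1)" using m by (simp add: algebra_simps)
      then show ?thesis by (simp only: cong_def mod_mult_self4 simp_thms)
    qed
  next
    assume "[p = 1] (mod (4 * k)) \<or> [p = 2 * k + 1] (mod (4 * k))"
    \<comment> \<open>The two classes modulo \<open>4 * k\<close> together form the class of 1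
      modulo \<open>2 * k\<close>.\<close>
    then have "[p = 1] (mod (2 * k))"
    proof
      assume "[p = 1] (mod (4 * k))"
      then show ?thesis by (rule cong_dvd_modulus_nat) simp
    next
      assume "[p = 2 * k + 1] (mod (4 * k))"
      then have "[p = 2 * k + 1] (mod (2 * k))" by (rule cong_dvd_modulus_nat) simp
      then show ?thesis by (simp only: cong_def mod_add_self1)
    qed
    then obtain m where "p = 2 * k * m + 1"
      using assms(2) cong_le_nat[of 1 p "2 * k"] by (auto simp: mult.commute)
    moreover from this have "m < M"
    proof -
      have "m \<le> 2 * k * m" using assms(1) by simp
      then show ?thesis using \<open>p = 2 * k * m + 1\<close> assms(3) by linarith
    qed
    ultimately show "p \<in> (\<lambda>m. 2 * k * m + 1) ` {..<M}" by auto
  qed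
  moreover have "p \<notin> (\<lambda>i. 2 * i) ` {1..2 * k * M}" using False by auto
  ultimately show ?thesis using False by (auto simp: B_parts_def)
qed

section \<open>Comparison of the coefficients at n\<close>

theorem theorem3:
  fixes k n :: nat
  assumes "k \<ge> 2"
  shows "B0 k n = C0 k n"
proof -
  have k: "0 < k" using assms by simp
  \<comment> \<open>\<open>M\<close> exceeds all parts, \<open>J\<close> makes the even product
    \<open>?E\<close> the same on both sides, and modulo \<open>fps_X ^ N\<close> the coefficient at
    \<open>n\<close> is still visible.\<close>
  define M where "M = n + 3"
  define J where "J = 2 * k * M"
  define N where "N = n + 1"
  let ?B = "pgf (\<lambda>P. set_mset P \<subseteq> B_parts k M)" and ?C = "pgf (gap_upto k J)"
  let ?E = "\<Prod>i\<in>{1..J}. 1 - fps_X ^ (2 * i) :: rat fps"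
  let ?R = "\<Prod>m<M. 1 + fps_X ^ (2 * k * m + 1) :: rat fps"
  have n_le: "n \<le> k * n" using k by simp
  have J_eq: "J = 2 * (k * n) + 6 * k" by (simp add: J_def M_def algebra_simps)
  have NJ: "N + 4 * k \<le> 2 * J" "N \<le> 2 * k * M" "n + 2 * k \<le> 2 * J"
    unfolding N_def J_def[symmetric] using k n_le J_eq by linarith+

  have BE: "?B * ?E = ?R" using pgf_B_parts[OF k] by (simp add: J_def)
  \<comment> \<open>Replace \<open>?C\<close> by \<open>?R * gap_fps k M J\<close>, then
    \<open>gap_fps k M J * ?E\<close> by 1: thus \<open>?C * ?E\<close> is congruent to
    \<open>?R = ?B * ?E\<close>, and the unit \<open>?E\<close> cancels.\<close>
  have "fps_X ^ N dvd (?C - ?R * gap_fps k M J) * ?E + ?R * (gap_fps k M J * ?E - 1)"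
    using gap_fps_cong_product[OF k NJ(1), of M] gap_fps_cong_large_s[OF k NJ(2), of J]
    by (simp add: pgf_gap_upto[OF k])
  moreover have "(c - r * g) * e + r * (g * e - 1) = (c - b) * e" if "b * e = r"
    for b c e g r :: "rat fps"
    using that by (simp add: algebra_simps)
  ultimately have "fps_X ^ N dvd (?C - ?B) * ?E" using BE by metis
  then have "fps_X ^ N dvd (?C - ?B) * ?E * inverse ?E" by simp
  moreover have "?E $ 0 \<noteq> 0"
    by (simp add: fps_prod_nth_0)
  then have "?E * inverse ?E = 1" by (rule inverse_mult_eq_1')
  ultimately have "fps_X ^ N dvd ?C - ?B" by (simp add: mult.assoc)
  then obtain D where "?C - ?B = fps_X ^ N * D" by (auto elim: dvdE)
  then have "(?C - ?B) $ n = 0" by (simp only: fps_X_power_mult_nth) (simp add: N_def)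
  then have CB: "card {P \<in> partitions n. gap_upto k J P} =
      card {P \<in> partitions n. set_mset P \<subseteq> B_parts k M}"
    by (simp add: pgf_nth)

  have bound: "0 < p \<and> p \<le> n" if "P \<in> partitions n" "p \<in># P" for P p
    using that part_le_sum_mset by (auto simp: partitions_def)
  \<comment> \<open>All parts are at most \<open>n\<close> and \<open>n + 2 * k \<le> 2 * J\<close>,
    so the bounds in \<open>gap_upto\<close> hold automatically.\<close>
  have "C0 k n = card {P \<in> partitions n. gap_upto k J P}"
    unfolding C0_def gap_cond_def[symmetric]
    using bound NJ(3) by (intro arg_cong[where f = card]) (fastforce simp: gap_upto_def)
  moreover have "B0 k n = card {P \<in> partitions n. set_mset P \<subseteq> B_parts k M}"
  proof -
    have "set_mset P \<subseteq> B_parts k M \<longleftrightarrow> (\<forall>p\<in>#P.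
        (even p \<and> \<not> [p = 2] (mod (4 * k))) \<or>
        (odd p \<and> ([p = 1] (mod (4 * k)) \<or> [p = 2 * k + 1] (mod (4 * k)))))"
      if "P \<in> partitions n" for P
    proof -
      have "p < M" if "p \<in># P" for p using bound[OF \<open>P \<in> partitions n\<close> that] by (simp add: M_def)
      then show ?thesis
        using mem_B_parts_iff[OF k] bound[OF that] by blast
    qed
    then show ?thesis unfolding B0_def by (intro arg_cong[where f = card]) blast
  qed
  ultimately show ?thesis using CB by simp
qed

end
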